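(* Let $n,p,t$ be integers with $p\ge 2$ and $1\le t\le p\le n$. Then $f_t^\sharp(n,p,2)$ exists; that is, there is a least positive integer $m$ for which a strong $(p,2,t)$-coloring of $B_n$ with $m$ colors exists.
   Context: $B_n=2^{[n]}$ denotes the Boolean lattice of all subsets of $[n]$ ordered by inclusion. A $t$-chain in a poset is a set of $t$ distinct pairwise comparable elements. An induced copy of a poset $P$ in a poset $R$ is the image $f(P)$ of an injection $f:P\to R$ such that $x\le y$ in $P$ if and only if $f(x)\le f(y)$ in $R$. A strong $(p,2,t)$-coloring of $B_n$ is a coloring of the $t$-chains of $B_n$ such that, for every induced copy $S\subseteq B_n$ of $B_p$, the $t$-chains contained in $S$ receive at least $2$ distinct colors. $f_t^\sharp(n,p,2)$ is the minimum number of colors in a strong $(p,2,t)$-coloring of $B_n$. *)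

theory Defs
  imports Main "HOL-Library.FuncSet"
begin

definition boolean_lattice :: "nat \<Rightarrow> nat set set" where
  "boolean_lattice n = Pow {1..n}"

definition t_chains :: "nat \<Rightarrow> 'a::order set \<Rightarrow> 'a set set" where
  "t_chains t R = {C. C \<subseteq> R \<and> finite C \<and> card C = t \<and> Complete_Partial_Order.chain (\<le>) C}"

definition induced_copy :: "'a::order set \<Rightarrow> 'b::order set \<Rightarrow> 'b set \<Rightarrow> bool" where
  "induced_copy P R S \<longleftrightarrow>
     (\<exists>f. f \<in> P \<rightarrow> R \<and> inj_on f P \<and> (\<forall>x\<in>P. \<forall>y\<in>P. x \<le> y \<longleftrightarrow> f x \<le> f y) \<and> S = f ` P)"

text \<open>A coloring with \<open>m\<close> colors takes its values in a fixed palette of \<open>m\<close> colors; not every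
  color has to be used. The values of \<open>c\<close> outside the \<open>t\<close>-chains of the Boolean lattice are
  irrelevant.\<close>

definition strong_coloring ::
    "nat \<Rightarrow> nat \<Rightarrow> nat \<Rightarrow> nat \<Rightarrow> nat \<Rightarrow> (nat set set \<Rightarrow> nat) \<Rightarrow> bool" where
  "strong_coloring n p q t m c \<longleftrightarrow>
     c \<in> t_chains t (boolean_lattice n) \<rightarrow> {1..m} \<and>
     (\<forall>S. induced_copy (boolean_lattice p) (boolean_lattice n) S \<longrightarrow> q \<le> card (c ` t_chains t S))"

text \<open>The minimum may fail to exist for some parameters, so \<open>f\<^sub>t\<^sup>\<sharp>(n,p,q) = m\<close> is
  introduced as a relation rather than as a total function.\<close>

definition is_f_sharp :: "nat \<Rightarrow> nat \<Rightarrow> nat \<Rightarrow> nat \<Rightarrow> nat \<Rightarrow> bool" where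
  "is_f_sharp t n p q m \<longleftrightarrow>
     0 < m \<and> (\<exists>c. strong_coloring n p q t m c) \<and>
     (\<forall>m'. 0 < m' \<and> (\<exists>c. strong_coloring n p q t m' c) \<longrightarrow> m \<le> m')"

end

theory Submission imports Defs begin

text \<open>
  A least \<open>m\<close> exists as soon as some \<open>m\<close> works, so the point is to exhibit one strong coloring.
  Give all \<open>t\<close>-chains of \<open>B\<^sub>n\<close>, of which there are finitely many, different colors. Then a copy of
  \<open>B\<^sub>p\<close> sees two colors as soon as it contains two \<open>t\<close>-chains. It does: it contains the image of
  the maximal chain \<open>{} \<subset> {1} \<subset> {1,2} \<subset> \<dots>\<close> of \<open>B\<^sub>p\<close>, which has \<open>p + 1 > t\<close> members, and
  deleting two different members from a chain of size \<open>t + 1\<close> leaves two different \<open>t\<close>-chains.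
\<close>

lemma t_chains_mono: "S \<subseteq> R \<Longrightarrow> t_chains t S \<subseteq> t_chains t R"
  by (auto simp: t_chains_def)

lemma finite_t_chains:
  assumes "finite R"
  shows "finite (t_chains t R)"
proof (rule finite_subset)
  show "t_chains t R \<subseteq> Pow R"
    by (auto simp: t_chains_def)
qed (simp add: assms)

lemma induced_copy_subset: "induced_copy P R S \<Longrightarrow> S \<subseteq> R"
  by (auto simp: induced_copy_def)

lemma induced_copy_has_t_chain:
  assumes "induced_copy P R S" and "C \<in> t_chains k P"
  shows "\<exists>D. D \<in> t_chains k S"
proof -
  obtain f where f: "inj_on f P" "\<forall>x\<in>P. \<forall>y\<in>P. x \<le> y \<longleftrightarrow> f x \<le> f y" "S = f ` P"
    using assms(1) by (auto simp: induced_copy_def)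
  have C: "C \<subseteq> P" "finite C" "card C = k" "Complete_Partial_Order.chain (\<le>) C"
    using assms(2) by (auto simp: t_chains_def)
  have "card (f ` C) = k"
    using C f(1) by (metis card_image inj_on_subset)
  moreover have "Complete_Partial_Order.chain (\<le>) (f ` C)"
    using C(1,4) f(2) unfolding Complete_Partial_Order.chain_def by blast
  ultimately have "f ` C \<in> t_chains k S"
    using C f(3) by (auto simp: t_chains_def)
  then show ?thesis ..
qed

lemma boolean_lattice_has_t_chain:
  assumes "k \<le> Suc p"
  shows "\<exists>C. C \<in> t_chains k (boolean_lattice p)"
proof -
  let ?g = "\<lambda>i::nat. {1..i}"
  have "inj_on ?g {..<k}"
    by (rule inj_on_inverseI[where g = card]) simp
  then have "card (?g ` {..<k}) = k"
    by (simp add: card_image)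
  moreover have "Complete_Partial_Order.chain (\<le>) (?g ` {..<k})"
    by (auto simp: Complete_Partial_Order.chain_def)
  ultimately have "?g ` {..<k} \<in> t_chains k (boolean_lattice p)"
    using assms by (auto simp: t_chains_def boolean_lattice_def)
  then show ?thesis ..
qed

lemma t_chain_remove:
  assumes "C \<in> t_chains (Suc t) S" and "x \<in> C"
  shows "C - {x} \<in> t_chains t S"
proof -
  have C: "C \<subseteq> S" "finite C" "card C = Suc t" "Complete_Partial_Order.chain (\<le>) C"
    using assms(1) by (auto simp: t_chains_def)
  have "Complete_Partial_Order.chain (\<le>) (C - {x})"
    using C(4) by (rule chain_subset) blast
  moreover have "card (C - {x}) = t"
    using C(3) assms(2) by simp
  ultimately show ?thesis
    using C(1,2) unfolding t_chains_def by blast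
qed

lemma two_t_chains:
  assumes "1 \<le> t" and "C \<in> t_chains (Suc t) S"
  shows "\<exists>A\<in>t_chains t S. \<exists>B\<in>t_chains t S. A \<noteq> B"
proof -
  have "Suc (Suc 0) \<le> card C"
    using assms by (auto simp: t_chains_def)
  then obtain x y where xy: "x \<in> C" "y \<in> C" "x \<noteq> y"
    by (metis card_le_Suc0_iff_eq card.infinite not_less_eq_eq zero_le)
  then have "C - {x} \<noteq> C - {y}"
    by blast
  then show ?thesis
    using t_chain_remove[OF assms(2) xy(1)] t_chain_remove[OF assms(2) xy(2)] by metis
qed

lemma strong_coloring_of_inj:
  assumes "inj_on c (t_chains t (boolean_lattice n))"
    and "c \<in> t_chains t (boolean_lattice n) \<rightarrow> {1..m}"
    and "1 \<le> t" and "t \<le> p"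
  shows "strong_coloring n p 2 t m c"
  unfolding strong_coloring_def
proof (intro conjI allI impI)
  fix S
  assume S: "induced_copy (boolean_lattice p) (boolean_lattice n) S"
  have sub: "t_chains t S \<subseteq> t_chains t (boolean_lattice n)"
    using S by (intro t_chains_mono induced_copy_subset)
  have "Suc t \<le> Suc p"
    using assms(4) by simp
  then obtain C where "C \<in> t_chains (Suc t) S"
    using boolean_lattice_has_t_chain induced_copy_has_t_chain[OF S] by blast
  then obtain A B where AB: "A \<in> t_chains t S" "B \<in> t_chains t S" "A \<noteq> B"
    using two_t_chains[OF assms(3)] by blast
  then have "c A \<noteq> c B"
    using assms(1) sub by (meson inj_onD subsetD)
  then have "2 = card {c A, c B}"
    by simp
  also have "\<dots> \<le> card (c ` t_chains t S)"
  proof (rule card_mono)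
    have "finite (t_chains t (boolean_lattice n))"
      by (simp add: boolean_lattice_def finite_t_chains)
    then show "finite (c ` t_chains t S)"
      using sub finite_subset by blast
  qed (use AB in auto)
  finally show "2 \<le> card (c ` t_chains t S)" .
qed (use assms(2) in blast)

text \<open>By the well-ordering of the naturals, only the existence of some coloring matters.\<close>

lemma is_f_sharp_exists:
  assumes "strong_coloring n p q t m c" and "0 < m"
  shows "\<exists>m. is_f_sharp t n p q m"
proof -
  let ?P = "\<lambda>m. 0 < m \<and> (\<exists>c. strong_coloring n p q t m c)"
  have "?P (LEAST m. ?P m)"
    by (rule LeastI[of ?P m]) (use assms in blast)
  then have "is_f_sharp t n p q (LEAST m. ?P m)"
    unfolding is_f_sharp_def using Least_le[of ?P] by blast
  then show ?thesis ..
qed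

theorem corollary3p6:
  fixes n p t :: nat
  assumes "p \<ge> 2" and "1 \<le> t" and "t \<le> p" and "p \<le> n"
  shows "\<exists>m. is_f_sharp t n p 2 m"
proof -
  let ?K = "t_chains t (boolean_lattice n)"
  have "finite ?K"
    by (simp add: boolean_lattice_def finite_t_chains)
  then obtain f :: "nat set set \<Rightarrow> nat" and k where f: "f ` ?K = {i. i < k}" "inj_on f ?K"
    using finite_imp_inj_to_nat_seg by blast
  \<comment> \<open>The extra color makes the palette nonempty without a count of the chains.\<close>
  have "strong_coloring n p 2 t (Suc k) (Suc \<circ> f)"
  proof (rule strong_coloring_of_inj)
    show "inj_on (Suc \<circ> f) ?K"
      using f(2) by (simp add: comp_inj_on)
    show "Suc \<circ> f \<in> ?K \<rightarrow> {1..Suc k}"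
    proof
      fix C assume "C \<in> ?K"
      then have "f C \<in> {i. i < k}"
        using f(1) by blast
      then show "(Suc \<circ> f) C \<in> {1..Suc k}"
        by simp
    qed
  qed (use assms in simp_all)
  then show ?thesis
    by (rule is_f_sharp_exists) simp
qed

end
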